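(* Let $G=\mathbb{R}^3=\{(x,y,z)\}$ be the Heisenberg group with the left-invariant vector fields $$X_1=\frac{\partial}{\partial x}-\frac y2\frac{\partial}{\partial z},\qquad X_2=\frac{\partial}{\partial y}+\frac x2\frac{\partial}{\partial z},\qquad X_3=\frac{\partial}{\partial z}.$$ Then the control system $$\dot q=\sum_{i=1}^3u_iX_i(q),\qquad q=(x,y,z)\in G,$$ $$u\in U=\{(u_1,u_2,u_3)\in\mathbb{R}^3\mid u_1^2+u_2^2-u_3^2\le 0,\ u_3\ge 0\}$$ is globally controllable on $G$.
   Context: In coordinates the system is $\dot x=u_1$, $\dot y=u_2$, $\dot z=-\frac y2u_1+\frac x2u_2+u_3$. An admissible trajectory is a Lipschitz curve $q:[0,t_1]\to G$, $t_1\ge 0$, satisfying $\dot q(t)=\sum_{i=1}^3u_i(t)X_i(q(t))$ for almost every $t$, with a measurable essentially bounded control $u:[0,t_1]\to U$. The system is globally controllable if for every pair of points $q_0,q_1\in G$ there exist $t_1\ge 0$ and an admissible trajectory $q:[0,t_1]\to G$ with $q(0)=q_0$ and $q(t_1)=q_1$. *)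

theory Defs
  imports "HOL-Analysis.Analysis"
begin

text \<open>Control-linear systems \<open>q' = (\<Sum>i. u\<^sub>i X\<^sub>i(q))\<close> with controls in a set \<open>U\<close>.  Controls are
  Lebesgue measurable, constrained to \<open>U\<close> at every time, and essentially bounded.
  For \<open>t1 = 0\<close> the almost-everywhere conditions are vacuous, so constant trajectories at a
  single instant are admissible.\<close>

definition control_rhs ::
    "('m::finite \<Rightarrow> 'a::euclidean_space \<Rightarrow> 'a) \<Rightarrow> real ^ 'm \<Rightarrow> 'a \<Rightarrow> 'a" where
  "control_rhs X u q = (\<Sum>i\<in>UNIV. (u $ i) *\<^sub>R X i q)"

definition admissible_control :: "(real ^ 'm::finite) set \<Rightarrow> real \<Rightarrow> (real \<Rightarrow> real ^ 'm) \<Rightarrow> bool" where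
  "admissible_control U t1 u \<longleftrightarrow>
     u \<in> borel_measurable (lebesgue_on {0..t1}) \<and>
     (\<forall>t\<in>{0..t1}. u t \<in> U) \<and>
     (\<exists>M. AE t in lebesgue_on {0..t1}. norm (u t) \<le> M)"

definition admissible_trajectory ::
    "('m::finite \<Rightarrow> 'a::euclidean_space \<Rightarrow> 'a) \<Rightarrow> (real ^ 'm) set \<Rightarrow> real \<Rightarrow> (real \<Rightarrow> 'a) \<Rightarrow> bool" where
  "admissible_trajectory X U t1 q \<longleftrightarrow>
     0 \<le> t1 \<and>
     (\<exists>L. L-lipschitz_on {0..t1} q) \<and>
     (\<exists>u. admissible_control U t1 u \<and>
       (AE t in lebesgue_on {0..t1}.
          (q has_vector_derivative control_rhs X (u t) (q t)) (at t within {0..t1})))"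

definition globally_controllable ::
    "('m::finite \<Rightarrow> 'a::euclidean_space \<Rightarrow> 'a) \<Rightarrow> (real ^ 'm) set \<Rightarrow> bool" where
  "globally_controllable X U \<longleftrightarrow>
     (\<forall>q0 q1. \<exists>t1 q. admissible_trajectory X U t1 q \<and> q 0 = q0 \<and> q t1 = q1)"

text \<open>The Heisenberg group on \<open>\<real>\<^sup>3\<close> with coordinates \<open>(x, y, z) = (q $ 1, q $ 2, q $ 3)\<close>.  The group
  law enters only through the left-invariance of the frame, proved below.\<close>

definition heisenberg_mult :: "real ^ 3 \<Rightarrow> real ^ 3 \<Rightarrow> real ^ 3" where
  "heisenberg_mult p q =
     vector [p $ 1 + q $ 1, p $ 2 + q $ 2,
             p $ 3 + q $ 3 + (p $ 1 * q $ 2 - q $ 1 * p $ 2) / 2]"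

definition X1 :: "real ^ 3 \<Rightarrow> real ^ 3" where
  "X1 q = vector [1, 0, - (q $ 2) / 2]"

definition X2 :: "real ^ 3 \<Rightarrow> real ^ 3" where
  "X2 q = vector [0, 1, (q $ 1) / 2]"

definition X3 :: "real ^ 3 \<Rightarrow> real ^ 3" where
  "X3 q = vector [0, 0, 1]"

definition heisenberg_frame :: "3 \<Rightarrow> real ^ 3 \<Rightarrow> real ^ 3" where
  "heisenberg_frame i = (if i = 1 then X1 else if i = 2 then X2 else X3)"

definition heisenberg_cone :: "(real ^ 3) set" where
  "heisenberg_cone = {u. (u $ 1)\<^sup>2 + (u $ 2)\<^sup>2 - (u $ 3)\<^sup>2 \<le> 0 \<and> 0 \<le> u $ 3}"

lemma control_rhs_heisenberg:
  "control_rhs heisenberg_frame u q =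
     vector [u $ 1, u $ 2, - (q $ 2) / 2 * u $ 1 + (q $ 1) / 2 * u $ 2 + u $ 3]"
  by (simp add: control_rhs_def heisenberg_frame_def X1_def X2_def X3_def sum_3 vec_eq_iff forall_3 mult.commute)

lemma heisenberg_frame_left_invariant:
  "\<exists>D. (heisenberg_mult p has_derivative D) (at q) \<and>
       D (heisenberg_frame i q) = heisenberg_frame i (heisenberg_mult p q)"
proof -
  define D :: "real ^ 3 \<Rightarrow> real ^ 3" where
    "D v = vector [v $ 1, v $ 2, v $ 3 + (p $ 1 * v $ 2 - v $ 1 * p $ 2) / 2]" for v
  have "linear D"
    by (rule linearI) (simp_all add: D_def vec_eq_iff forall_3 field_simps)
  then have "(D has_derivative D) (at q)"
    by (simp add: linear_conv_bounded_linear bounded_linear_imp_has_derivative)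
  then have "((\<lambda>q. p + D q) has_derivative D) (at q)"
    by (auto intro!: derivative_eq_intros)
  moreover have "(\<lambda>q. p + D q) = heisenberg_mult p"
    by (simp add: fun_eq_iff D_def heisenberg_mult_def vec_eq_iff forall_3)
  moreover have "D (heisenberg_frame i q) = heisenberg_frame i (heisenberg_mult p q)"
    by (simp add: D_def heisenberg_mult_def heisenberg_frame_def X1_def X2_def X3_def
        vec_eq_iff forall_3 field_simps)
  ultimately show ?thesis by auto
qed

end

theory Submission
  imports Defs
begin

text \<open>A planar curve \<open>(x, y)\<close> together with a constant control \<open>u\<^sub>3 = c\<close> dominating its speed lifts to
  an admissible trajectory, and the change of \<open>z\<close> is \<open>c\<close> plus the signed area swept by the curve.
  Add to the straight segment between the prescribed planar endpoints a closed loop of negative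
  orientation scaled by \<open>R\<close>: the speed grows linearly in \<open>R\<close> while the area decreases quadratically,
  so for large \<open>R\<close> the value of \<open>c\<close> that realises the prescribed end value of \<open>z\<close> is large enough to
  dominate the speed.\<close>

text \<open>On a compact interval continuity of \<open>u\<close> and \<open>q\<close> bounds both
  the control and the velocity; the velocity bound gives the Lipschitz constant. The
  almost-everywhere conditions then hold at every time.\<close>

lemma admissible_trajectory_of_continuous_control:
  fixes X :: "'m::finite \<Rightarrow> 'a::euclidean_space \<Rightarrow> 'a"
  assumes "0 \<le> t1"
    and X: "\<And>i. continuous_on UNIV (X i)"
    and u: "continuous_on {0..t1} u"
    and U: "\<And>t. t \<in> {0..t1} \<Longrightarrow> u t \<in> U"
    and q: "\<And>t. t \<in> {0..t1} \<Longrightarrow>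
      (q has_vector_derivative control_rhs X (u t) (q t)) (at t within {0..t1})"
  shows "admissible_trajectory X U t1 q"
proof -
  let ?q' = "\<lambda>t. control_rhs X (u t) (q t)"
  have qc: "continuous_on {0..t1} q"
    using q by (meson continuous_on_eq_continuous_within has_vector_derivative_continuous)
  have "continuous_on {0..t1} (\<lambda>t. X i (q t))" for i
    using continuous_on_compose2[OF X qc] by simp
  then have "continuous_on {0..t1} ?q'"
    unfolding control_rhs_def by (intro continuous_intros u)
  then have "bounded (?q' ` {0..t1})"
    by (simp add: compact_continuous_image compact_imp_bounded)
  then obtain L where L: "0 < L" "\<And>t. t \<in> {0..t1} \<Longrightarrow> norm (?q' t) \<le> L"
    by (auto simp: bounded_pos)
  have "L-lipschitz_on {0..t1} q"
  proof (rule bounded_derivative_imp_lipschitz)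
    show "(q has_derivative (\<lambda>h. h *\<^sub>R ?q' t)) (at t within {0..t1})" if "t \<in> {0..t1}" for t
      using q[OF that] by (simp add: has_vector_derivative_def)
    show "onorm (\<lambda>h. h *\<^sub>R ?q' t) \<le> L" if "t \<in> {0..t1}" for t
      using L(1) L(2)[OF that]
      by (intro onorm_bound) (auto simp: mult.commute[of L] mult_left_mono)
  qed (use L in auto)
  moreover have "admissible_control U t1 u"
  proof -
    have "bounded (u ` {0..t1})"
      using u by (simp add: compact_continuous_image compact_imp_bounded)
    then obtain M where M: "\<And>t. t \<in> {0..t1} \<Longrightarrow> norm (u t) \<le> M"
      unfolding bounded_iff by blast
    have "u \<in> borel_measurable (lebesgue_on {0..t1})"
      using u by (rule continuous_imp_measurable_on_sets_lebesgue) simp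
    moreover have "AE t in lebesgue_on {0..t1}. norm (u t) \<le> M"
      using M by (intro AE_I2) simp
    ultimately show ?thesis
      using U by (auto simp: admissible_control_def)
  qed
  moreover have "AE t in lebesgue_on {0..t1}.
      (q has_vector_derivative ?q' t) (at t within {0..t1})"
    using q by (intro AE_I2) simp
  ultimately show ?thesis
    using assms(1) by (auto simp: admissible_trajectory_def)
qed

text \<open>Makes coordinatewise continuity and differentiation consequences of linearity.\<close>

lemma vector_3_eq_axis:
  "(vector [a, b, c] :: real ^ 3) = a *\<^sub>R axis 1 1 + b *\<^sub>R axis 2 1 + c *\<^sub>R axis 3 1"
  by (simp add: vec_eq_iff forall_3 axis_def)

lemma has_vector_derivative_vector_3:
  assumes "(f has_real_derivative f') F" "(g has_real_derivative g') F"
    and "(h has_real_derivative h') F"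
  shows "((\<lambda>t. vector [f t, g t, h t] :: real ^ 3) has_vector_derivative vector [f', g', h']) F"
  unfolding vector_3_eq_axis
  using assms unfolding has_real_derivative_iff_has_vector_derivative
  by (intro has_vector_derivative_add
      bounded_linear.has_vector_derivative[OF bounded_linear_scaleR_left])

lemma continuous_on_vector_3:
  assumes "continuous_on S f" "continuous_on S g" "continuous_on S h"
  shows "continuous_on S (\<lambda>t. vector [f t, g t, h t] :: real ^ 3)"
  unfolding vector_3_eq_axis using assms by (intro continuous_intros)

lemma continuous_on_heisenberg_frame: "continuous_on UNIV (heisenberg_frame i)"
proof -
  have "continuous_on UNIV X1" "continuous_on UNIV X2" "continuous_on UNIV X3"
    unfolding X1_def X2_def X3_def by (intro continuous_on_vector_3 continuous_intros; simp)+
  then show ?thesis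
    by (simp add: heisenberg_frame_def)
qed

text \<open>The 1-norm dominates the Euclidean norm, so a linear speed bound replaces the quadratic
  cone condition.\<close>

lemma mem_heisenberg_coneI:
  assumes "\<bar>u $ 1\<bar> + \<bar>u $ 2\<bar> \<le> u $ 3"
  shows "u \<in> heisenberg_cone"
proof -
  have "(u $ 1)\<^sup>2 + (u $ 2)\<^sup>2 \<le> (\<bar>u $ 1\<bar> + \<bar>u $ 2\<bar>)\<^sup>2"
    by (simp add: power2_sum)
  also have "\<dots> \<le> (u $ 3)\<^sup>2"
    using assms by (intro power_mono) auto
  finally show ?thesis
    using assms by (simp add: heisenberg_cone_def)
qed

lemma quadratic_dominates_linear:
  fixes a b :: real
  assumes "0 \<le> a"
  shows "\<exists>R\<ge>0. a * R + b \<le> R\<^sup>2"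
proof (intro exI conjI)
  \<comment> \<open>With this choice \<open>?R\<^sup>2 - a * ?R = (\<bar>b\<bar> + 1) * ?R\<close>,
    and \<open>?R\<close> is at least 1.\<close>
  let ?R = "a + \<bar>b\<bar> + 1"
  show "0 \<le> ?R" using assms by simp
  have "\<bar>b\<bar> * 1 \<le> (\<bar>b\<bar> + 1) * ?R"
    using assms by (intro mult_mono) auto
  then show "a * ?R + b \<le> ?R\<^sup>2"
    by (simp add: power2_eq_square algebra_simps)
qed

theorem mainTheorem1: "globally_controllable heisenberg_frame heisenberg_cone"
  unfolding globally_controllable_def
proof (intro allI)
  fix q0 q1 :: "real ^ 3"
  define x0 y0 where "x0 = q0 $ 1" and "y0 = q0 $ 2"
  define d e where "d = q1 $ 1 - x0" and "e = q1 $ 2 - y0"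
  \<comment> \<open>The constant third control that would reach the end value of z along the
    straight segment alone.\<close>
  define k where "k = q1 $ 3 - q0 $ 3 - (x0 * e - y0 * d) / 2"
  \<comment> \<open>This is 30 times \<open>\<bar>d\<bar> + \<bar>e\<bar> + 2 * R \<le> k -
    \<bar>e\<bar> * R / 6 + R\<^sup>2 / 30\<close>.\<close>
  obtain R where R: "0 \<le> R" "(60 + 5 * \<bar>e\<bar>) * R + 30 * (\<bar>d\<bar> + \<bar>e\<bar> - k) \<le> R\<^sup>2"
    using quadratic_dominates_linear[of "60 + 5 * \<bar>e\<bar>" "30 * (\<bar>d\<bar> + \<bar>e\<bar> - k)"] by auto
  \<comment> \<open>The corrections to \<open>k\<close> cancel the area \<open>e * R / 6\<close>
    from the interaction of segment and loop, and the area \<open>- R\<^sup>2 / 30\<close> of the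
    scaled loop.\<close>
  define c where "c = k - e * R / 6 + R\<^sup>2 / 30"
  have "e * R \<le> \<bar>e\<bar> * R"
    using R(1) by (intro mult_right_mono) auto
  then have c: "\<bar>d\<bar> + \<bar>e\<bar> + 2 * R \<le> c"
    using R(2) by (simp add: c_def algebra_simps)
  txt \<open>The closed loop is \<open>(t (1 - t), t (1 - t) (1 - 2 t))\<close>, of signed area \<open>- 1 / 30\<close>.\<close>
  define \<xi> where "\<xi> t = d * t + R * (t - t^2)" for t
  define \<eta> where "\<eta> t = e * t + R * (t - 3 * t^2 + 2 * t^3)" for t
  \<comment> \<open>The integrated z-equation: the last bracket is the antiderivative of \<xi>
    \<eta>' - \<eta> \<xi>', twice the swept area; the \<open>d * e\<close> terms cancel in it. The
    base point contributes the \<open>x0\<close>, \<open>y0\<close> terms.\<close>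
  define \<zeta> where "\<zeta> t = q0 $ 3 + c * t + (x0 * \<eta> t - y0 * \<xi> t) / 2
    + (d * R * (t^4 - t^3) + e * R * t^3 / 3 + R\<^sup>2 * (t^4 - 2 * t^3 / 3 - 2 * t^5 / 5)) / 2" for t
  define u1 u2 where "u1 t = d + R * (1 - 2 * t)" and "u2 t = e + R * (1 - 6 * t + 6 * t^2)" for t
  define u :: "real \<Rightarrow> real ^ 3" where "u t = vector [u1 t, u2 t, c]" for t
  define q :: "real \<Rightarrow> real ^ 3" where "q t = vector [x0 + \<xi> t, y0 + \<eta> t, \<zeta> t]" for t
  have "admissible_trajectory heisenberg_frame heisenberg_cone 1 q"
  proof (rule admissible_trajectory_of_continuous_control)
    show "continuous_on {0..1} u"
      unfolding u_def u1_def u2_def by (intro continuous_on_vector_3 continuous_intros)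
    show "u t \<in> heisenberg_cone" if "t \<in> {0..1}" for t
    proof (rule mem_heisenberg_coneI)
      \<comment> \<open>The second polynomial below equals \<open>1 - 6 * t * (1 - t)\<close> and
        also \<open>3 / 2 * (1 - 2 * t)\<^sup>2 - 1 / 2\<close>, which gives its upper and lower
        bounds.\<close>
      have "0 \<le> t * (1 - t)" "0 \<le> (1 - 2 * t)\<^sup>2"
        using that by simp_all
      then have "\<bar>1 - 2 * t\<bar> \<le> 1" "\<bar>1 - 6 * t + 6 * t^2\<bar> \<le> 1"
        using that by (auto simp: abs_le_iff power2_eq_square algebra_simps)
      then have "\<bar>R * (1 - 2 * t)\<bar> \<le> R" "\<bar>R * (1 - 6 * t + 6 * t^2)\<bar> \<le> R"
        using R(1) by (simp_all add: abs_mult mult_left_le)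
      then show "\<bar>u t $ 1\<bar> + \<bar>u t $ 2\<bar> \<le> u t $ 3"
        using c by (simp add: u_def u1_def u2_def)
    qed
    show "(q has_vector_derivative control_rhs heisenberg_frame (u t) (q t)) (at t within {0..1})"
      for t
    proof -
      have \<xi>: "(\<xi> has_real_derivative u1 t) (at t within {0..1})"
        unfolding \<xi>_def u1_def by (auto intro!: derivative_eq_intros simp: algebra_simps)
      have \<eta>: "(\<eta> has_real_derivative u2 t) (at t within {0..1})"
        unfolding \<eta>_def u2_def by (auto intro!: derivative_eq_intros simp: algebra_simps)
      have "(\<zeta> has_real_derivative c + (x0 * u2 t - y0 * u1 t) / 2
          + (d * R * (4 * t^3 - 3 * t^2) + e * R * t^2 + R\<^sup>2 * (4 * t^3 - 2 * t^2 - 2 * t^4)) / 2)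
          (at t within {0..1})"
        unfolding \<zeta>_def using \<xi> \<eta> by (auto intro!: derivative_eq_intros simp: field_simps)
      also have "c + (x0 * u2 t - y0 * u1 t) / 2
          + (d * R * (4 * t^3 - 3 * t^2) + e * R * t^2 + R\<^sup>2 * (4 * t^3 - 2 * t^2 - 2 * t^4)) / 2
        = - (y0 + \<eta> t) / 2 * u1 t + (x0 + \<xi> t) / 2 * u2 t + c"
        unfolding \<xi>_def \<eta>_def u1_def u2_def
        by (simp add: field_simps power2_eq_square power3_eq_cube power4_eq_xxxx)
      finally have \<zeta>: "(\<zeta> has_real_derivative \<dots>) (at t within {0..1})" .
      have "((\<lambda>t. x0 + \<xi> t) has_real_derivative u1 t) (at t within {0..1})"
        "((\<lambda>t. y0 + \<eta> t) has_real_derivative u2 t) (at t within {0..1})"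
        using \<xi> \<eta> by (auto intro!: derivative_eq_intros)
      from has_vector_derivative_vector_3[OF this \<zeta>] show ?thesis
        by (simp add: control_rhs_heisenberg q_def[abs_def] u_def)
    qed
  qed (simp_all add: continuous_on_heisenberg_frame)
  moreover have "q 0 = q0"
    by (simp add: q_def \<xi>_def \<eta>_def \<zeta>_def x0_def y0_def vec_eq_iff forall_3)
  moreover have "q 1 = q1"
    by (simp add: q_def \<xi>_def \<eta>_def \<zeta>_def c_def k_def d_def e_def vec_eq_iff forall_3 field_simps)
  ultimately show "\<exists>t1 q. admissible_trajectory heisenberg_frame heisenberg_cone t1 q \<and>
      q 0 = q0 \<and> q t1 = q1"
    by blast
qed

end
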